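(* Let $A$ be a real symmetric positive-definite $n\times n$ matrix, $t>0$, and $r=\frac{t}{\|A\|}$. Then the $m_\infty$ bound is sharper than the relaxed Hanson-Wright bound, the relaxed Laurent-Massart bound and the large-deviations bound, i.e.: (1) $\Big(1+\frac rn\Big)^{\frac n2}e^{-\frac r2}<e^{-\kappa\min\{\frac{r^2}{n},\,r\}}$ with $\kappa=\frac{9-\sqrt{17}}{32}$; (2) $\Big(1+\frac rn\Big)^{\frac n2}e^{-\frac r2}<e^{-\frac n4\big(\sqrt{1+\frac{2r}{n}}-1\big)^2}$; (3) if $n\ge2$ and $r\ge n-1$, then $\Big(1+\frac rn\Big)^{\frac n2}e^{-\frac r2}<\frac{1}{\sqrt e}\Big(\frac{e(1+r)}{n}\Big)^{\frac n2}e^{-\frac r2}$.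
   Context: $\|A\|$ is the operator norm of $A$. Each of the four expressions is an upper bound on $\Pr(\underline{\boldsymbol{x}}^{\mathsf T}A\underline{\boldsymbol{x}}-\mathrm{tr}(A)>t)$ for $\underline{\boldsymbol{x}}\sim N(\underline 0,I_n)$; the large-deviations bound (right side of (3)) is only defined/valid for $r\ge n-1$. "Sharper" means strictly smaller. *)

theory Defs
  imports "HOL-Analysis.Analysis"
begin

definition symmetric_matrix :: "real ^ 'n ^ 'n \<Rightarrow> bool" where
  "symmetric_matrix A \<longleftrightarrow> transpose A = A"

text \<open>Symmetry is kept as a separate hypothesis and is not part of this predicate.\<close>

definition positive_definite_matrix :: "real ^ 'n ^ 'n \<Rightarrow> bool" where
  "positive_definite_matrix A \<longleftrightarrow> (\<forall>x. x \<noteq> 0 \<longrightarrow> x \<bullet> (A *v x) > 0)"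

end

theory Submission
  imports Defs
begin

text \<open>
  The matrix only matters through \<open>r\<close>: positive definiteness makes \<open>A\<close> nonzero, so its
  operator norm, and hence \<open>r\<close>, is positive. Taking logarithms and writing \<open>s = r / n\<close>, the
  \<open>m\<^sub>\<infinity>\<close> bound becomes \<open>n / 2 * (ln (1 + s) - s)\<close>, and the three claims turn into
  elementary inequalities in which the dimension is gone or nearly so.

  Against the Hanson--Wright bound the claim is \<open>c * min s\<^sup>2 s < s - ln (1 + s)\<close> with
  \<open>c = 2 * \<kappa>\<close>. The two branches meet at \<open>s = 1\<close>, which is the worst case for each of them, so
  everything reduces to \<open>c < 1 - ln 2\<close>. The margin there is small
  (\<open>0.3048\<close> against \<open>0.3068\<close>).

  Against the Laurent--Massart bound, the substitution \<open>w = sqrt (1 + 2 * s) - 1\<close> gives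
  \<open>1 + s = 1 + w + w\<^sup>2 / 2\<close>, and the claim is that the exponential strictly exceeds its
  quadratic Taylor polynomial.

  Against the large-deviations bound, the claim is \<open>n * ln ((n + r) / (1 + r)) < n - 1\<close>. It
  follows from \<open>ln (1 + x) < x\<close> at \<open>x = (n - 1) / (1 + r)\<close>, which is at most
  \<open>(n - 1) / n\<close> exactly in the range \<open>r \<ge> n - 1\<close>.
\<close>

section \<open>Inequalities for the logarithm\<close>

text \<open>
  The function \<open>s - ln (1 + s) - c * s\<^sup>2\<close> has derivative \<open>s * (1 / (1 + s) - 2 * c)\<close>: it rises
  from its value \<open>0\<close> at the origin and then falls, so on the unit interval it stays
  above the smaller of its two boundary values.
\<close>

lemma quadratic_less_self_minus_ln:
  fixes s c :: real
  assumes s: "0 < s" "s \<le> 1" and c: "0 < c" "c < 1 - ln 2"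
  shows "c * s\<^sup>2 < s - ln (1 + s)"
proof -
  define h where "h = (\<lambda>x::real. x - ln (1 + x) - c * x\<^sup>2)"
  have deriv: "(h has_real_derivative x * (1 / (1 + x) - 2 * c)) (at x)" if "0 \<le> x" for x
    unfolding h_def using that
    by (auto intro!: derivative_eq_intros simp: field_simps power2_eq_square)
  have "0 < h s"
  proof (cases "2 * c * (1 + s) \<le> 1")
    case True
    have "h 0 < h s"
    proof (rule DERIV_pos_imp_increasing_open[OF s(1)])
      fix x assume x: "0 < x" "x < s"
      then have "2 * c * (1 + x) < 2 * c * (1 + s)"
        using c by simp
      with True have "2 * c * (1 + x) < 1"
        by linarith
      then have "0 < 1 / (1 + x) - 2 * c"
        using x by (simp add: pos_less_divide_eq)
      then have "0 < x * (1 / (1 + x) - 2 * c)"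
        using x by simp
      then show "\<exists>y. (h has_real_derivative y) (at x) \<and> 0 < y"
        using deriv[of x] x by (metis less_imp_le)
    next
      show "continuous_on {0..s} h"
        by (intro DERIV_continuous_on[where D = "\<lambda>x. x * (1 / (1 + x) - 2 * c)"])
          (auto intro: has_field_derivative_at_within deriv)
    qed
    then show ?thesis
      by (simp add: h_def)
  next
    case False
    have "h 1 \<le> h s"
    proof (rule DERIV_nonpos_imp_nonincreasing[OF s(2)])
      fix x assume x: "s \<le> x" "x \<le> 1"
      then have "2 * c * (1 + s) \<le> 2 * c * (1 + x)"
        using c by simp
      with False have "1 \<le> 2 * c * (1 + x)"
        by linarith
      then have "1 / (1 + x) - 2 * c \<le> 0"
        using x s by (simp add: field_simps)
      then have "x * (1 / (1 + x) - 2 * c) \<le> 0"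
        using x s by (intro mult_nonneg_nonpos) auto
      then show "\<exists>y. (h has_real_derivative y) (at x) \<and> y \<le> 0"
        using deriv[of x] x s by (metis less_imp_le order_trans)
    qed
    moreover have "0 < h 1"
      using c by (simp add: h_def)
    ultimately show ?thesis
      by linarith
  qed
  then show ?thesis
    by (simp add: h_def)
qed

text \<open>
  The tangent of \<open>ln (1 + s)\<close> at \<open>s = 1\<close> has slope \<open>1 / 2\<close>, and \<open>c < 1 - ln 2 \<le> 1 / 2\<close>, so the
  inequality at \<open>s = 1\<close> persists to the right of \<open>1\<close>.
\<close>

lemma linear_less_self_minus_ln:
  fixes s c :: real
  assumes s: "1 \<le> s" and c: "c < 1 - ln 2"
  shows "c * s < s - ln (1 + s)"
proof -
  define x where "x = (s - 1) / 2"
  have x: "0 \<le> x" "1 + s = 2 * (1 + x)"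
    using s by (auto simp: x_def field_simps)
  have "ln (1 + s) = ln 2 + ln (1 + x)"
    unfolding x(2) using x(1) by (intro ln_mult_pos) auto
  also have "\<dots> \<le> ln 2 + (s - 1) / 2"
    using ln_add_one_self_le_self[OF x(1)] by (simp add: x_def)
  finally have "ln (1 + s) \<le> ln 2 + (s - 1) / 2" .
  moreover have "(1 / 2) * (s - 1) \<le> ln 2 * (s - 1)"
    using s ln2_ge_two_thirds by (intro mult_right_mono) auto
  moreover have "c * s < (1 - ln 2) * s"
    using s c by (intro mult_strict_right_mono) auto
  ultimately show ?thesis
    by (simp add: algebra_simps)
qed

lemma min_square_self_less_self_minus_ln:
  fixes s c :: real
  assumes "0 < s" "0 < c" "c < 1 - ln 2"
  shows "c * min (s\<^sup>2) s < s - ln (1 + s)"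
proof (cases "s \<le> 1")
  case True
  then have "min (s\<^sup>2) s = s\<^sup>2"
    using assms by (simp add: min_def power2_eq_square mult_le_cancel_left1)
  then show ?thesis
    using quadratic_less_self_minus_ln assms True by simp
next
  case False
  then have "min (s\<^sup>2) s = s"
    using assms by (simp add: min_def power2_eq_square mult_le_cancel_left1)
  then show ?thesis
    using linear_less_self_minus_ln assms False by simp
qed

text \<open>
  Squaring the weak form of the inequality at \<open>w / 2\<close> leaves the surplus
  \<open>w\<^sup>3 / 8 + w\<^sup>4 / 64\<close>, which yields strictness.
\<close>

lemma quadratic_Taylor_less_exp:
  fixes w :: real
  assumes "0 < w"
  shows "1 + w + w\<^sup>2 / 2 < exp w"
proof -
  have "1 + w + w\<^sup>2 / 2 < 1 + w + w\<^sup>2 / 2 + (w ^ 3 / 8 + w ^ 4 / 64)"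
    using assms by (simp add: add_pos_pos)
  also have "\<dots> = (1 + w / 2 + (w / 2)\<^sup>2 / 2)\<^sup>2"
    by (simp add: field_simps power2_eq_square power3_eq_cube power4_eq_xxxx)
  also have "\<dots> \<le> (exp (w / 2))\<^sup>2"
    using assms by (intro power_mono exp_lower_Taylor_quadratic) auto
  also have "\<dots> = exp w"
    by (simp add: power2_eq_square flip: exp_add)
  finally show ?thesis .
qed

lemma ln_one_plus_less_sqrt:
  fixes s :: real
  assumes "0 < s"
  shows "ln (1 + s) < sqrt (1 + 2 * s) - 1"
proof -
  define w where "w = sqrt (1 + 2 * s) - 1"
  have "(w + 1)\<^sup>2 = 1 + 2 * s"
    using assms by (simp add: w_def)
  then have "1 + s = 1 + w + w\<^sup>2 / 2"
    by (simp add: power2_eq_square algebra_simps)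
  also have "\<dots> < exp w"
    using assms by (intro quadratic_Taylor_less_exp) (simp add: w_def)
  finally have "ln (1 + s) < ln (exp w)"
    using assms by (subst ln_less_cancel_iff) auto
  then show ?thesis
    by (simp add: w_def)
qed

lemma ln_ratio_less:
  fixes n r :: real
  assumes "1 < n" "n - 1 \<le> r"
  shows "n * (ln (n + r) - ln (1 + r)) < n - 1"
proof -
  define x where "x = (n - 1) / (1 + r)"
  have x: "0 < x"
    using assms by (simp add: x_def)
  have "ln (n + r) - ln (1 + r) = ln (1 + x)"
  proof -
    have "1 + x = (n + r) / (1 + r)"
      using assms by (simp add: x_def field_simps)
    then show ?thesis
      using assms by (simp add: ln_div)
  qed
  also have "\<dots> < x"
    using ln_add_one_self_less_self[OF x] .
  also have "x \<le> (n - 1) / n"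
    unfolding x_def using assms by (intro divide_left_mono) auto
  finally show ?thesis
    using assms by (simp add: field_simps)
qed

section \<open>Comparison of the tail bounds\<close>

lemma m_infinity_bound_eq_exp:
  fixes n r :: real
  assumes "0 < n" "0 < r"
  shows "(1 + r / n) powr (n / 2) * exp (- r / 2) = exp (n / 2 * (ln (1 + r / n) - r / n))"
proof -
  have "1 + r / n > 0"
    using assms by (simp add: add_pos_pos)
  then have "(1 + r / n) powr (n / 2) * exp (- r / 2) = exp (n / 2 * ln (1 + r / n) + - r / 2)"
    unfolding exp_add by (simp add: powr_def)
  also have "n / 2 * ln (1 + r / n) + - r / 2 = n / 2 * (ln (1 + r / n) - r / n)"
    using assms by (simp add: field_simps)
  finally show ?thesis .
qed

lemma m_infinity_less_Hanson_Wright: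
  fixes n r k :: real
  assumes "0 < n" "0 < r" "0 < k" "2 * k < 1 - ln 2"
  shows "(1 + r / n) powr (n / 2) * exp (- r / 2) < exp (- k * min (r\<^sup>2 / n) r)"
proof -
  define s where "s = r / n"
  have s: "0 < s" and r: "r = n * s"
    using assms by (auto simp: s_def)
  have "r\<^sup>2 / n = n * s\<^sup>2"
    using assms by (simp add: r power2_eq_square)
  then have min: "min (r\<^sup>2 / n) r = n * min (s\<^sup>2) s"
    using assms by (simp add: r min_mult_distrib_left)
  have "n / 2 * (2 * k * min (s\<^sup>2) s) < n / 2 * (s - ln (1 + s))"
    using assms s by (intro mult_strict_left_mono min_square_self_less_self_minus_ln) auto
  then have "n / 2 * (ln (1 + s) - s) < - k * (n * min (s\<^sup>2) s)"
    by (simp add: algebra_simps)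
  then show ?thesis
    unfolding m_infinity_bound_eq_exp[OF assms(1,2)] exp_less_cancel_iff min s_def .
qed

lemma m_infinity_less_Laurent_Massart:
  fixes n r :: real
  assumes "0 < n" "0 < r"
  shows "(1 + r / n) powr (n / 2) * exp (- r / 2)
    < exp (- (n / 4) * (sqrt (1 + 2 * r / n) - 1)\<^sup>2)"
proof -
  define s where "s = r / n"
  have s: "0 < s"
    using assms by (simp add: s_def)
  have "(sqrt (1 + 2 * s))\<^sup>2 = 1 + 2 * s"
    using s by simp
  then have square: "(sqrt (1 + 2 * s) - 1)\<^sup>2 = 2 * (1 + s - sqrt (1 + 2 * s))"
    by (simp add: power2_eq_square algebra_simps)
  have "n / 2 * (ln (1 + s) - s) < n / 2 * (sqrt (1 + 2 * s) - 1 - s)"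
    using assms ln_one_plus_less_sqrt[OF s] by (intro mult_strict_left_mono) auto
  also have "\<dots> = - (n / 4) * (sqrt (1 + 2 * s) - 1)\<^sup>2"
    unfolding square by (simp add: field_simps)
  finally show ?thesis
    unfolding m_infinity_bound_eq_exp[OF assms] by (simp add: s_def)
qed

lemma m_infinity_less_large_deviations:
  fixes n r :: real
  assumes "1 < n" "n - 1 \<le> r"
  shows "(1 + r / n) powr (n / 2) * exp (- r / 2)
    < 1 / sqrt (exp 1) * (exp 1 * (1 + r) / n) powr (n / 2) * exp (- r / 2)"
proof -
  have sqrt: "sqrt (exp 1) = exp (1 / 2 :: real)"
    by (rule real_sqrt_unique) (simp_all add: power2_eq_square flip: exp_add)
  have "1 + r / n = (n + r) / n"
    using assms by (simp add: field_simps)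
  then have "(1 + r / n) powr (n / 2) = exp (n / 2 * (ln (n + r) - ln n))"
    using assms by (simp add: powr_def ln_div)
  also have "\<dots> < exp (n / 2 * (1 + ln (1 + r) - ln n) - 1 / 2)"
    using ln_ratio_less[OF assms] by (simp add: field_simps)
  also have "\<dots> = 1 / sqrt (exp 1) * (exp 1 * (1 + r) / n) powr (n / 2)"
    using assms by (simp add: sqrt exp_diff powr_def ln_div ln_mult)
  finally show ?thesis
    by (rule mult_strict_right_mono) simp
qed

text \<open>
  Here \<open>25 / 36\<close> as upper bound for \<open>ln 2\<close> and \<open>4.12\<close> as lower bound for \<open>sqrt 17\<close> are just
  precise enough: \<open>25 / 36 < 0.695 = (7 + 4.12) / 16\<close>.
\<close>

lemma Hanson_Wright_constant_less: "2 * ((9 - sqrt 17) / 32) < 1 - ln 2"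
proof -
  have "4.12 < sqrt 17"
    by (rule real_less_rsqrt) (simp add: power2_eq_square)
  then show ?thesis
    using ln2_le_25_over_36 by simp
qed

lemma onorm_positive_definite_pos:
  fixes A :: "real ^ 'n ^ 'n"
  assumes "positive_definite_matrix A"
  shows "0 < onorm (\<lambda>x. A *v x)"
proof -
  have "(1 :: real ^ 'n) \<noteq> 0"
    by simp
  then have "0 < (1 :: real ^ 'n) \<bullet> (A *v 1)"
    using assms unfolding positive_definite_matrix_def by blast
  then have "A *v 1 \<noteq> 0"
    by auto
  then show ?thesis
    using onorm_pos_lt[OF matrix_vector_mul_bounded_linear[of A]] by blast
qed

theorem proposition4:
  fixes A :: "real ^ 'n ^ 'n" and t r n \<kappa> :: real
  assumes "symmetric_matrix A"
    and "positive_definite_matrix A"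
    and "t > 0"
    and "r = t / onorm (\<lambda>x. A *v x)"
    and "n = real CARD('n)"
    and "\<kappa> = (9 - sqrt 17) / 32"
  shows "(1 + r / n) powr (n / 2) * exp (- r / 2) < exp (- \<kappa> * min (r\<^sup>2 / n) r)
    \<and> (1 + r / n) powr (n / 2) * exp (- r / 2)
        < exp (- (n / 4) * (sqrt (1 + 2 * r / n) - 1)\<^sup>2)
    \<and> (n \<ge> 2 \<and> r \<ge> n - 1 \<longrightarrow>
        (1 + r / n) powr (n / 2) * exp (- r / 2)
          < 1 / sqrt (exp 1) * (exp 1 * (1 + r) / n) powr (n / 2) * exp (- r / 2))"
proof -
  have r: "0 < r"
    using assms(3,4) onorm_positive_definite_pos[OF assms(2)] by simp
  have n: "0 < n"
    using assms by simp
  have "sqrt 17 < 9"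
    by (rule real_less_lsqrt) auto
  then have \<kappa>: "0 < \<kappa>" "2 * \<kappa> < 1 - ln 2"
    using assms(6) Hanson_Wright_constant_less by auto
  show ?thesis
  proof (intro conjI impI)
    show "(1 + r / n) powr (n / 2) * exp (- r / 2) < exp (- \<kappa> * min (r\<^sup>2 / n) r)"
      using m_infinity_less_Hanson_Wright[OF n r \<kappa>] .
  next
    show "(1 + r / n) powr (n / 2) * exp (- r / 2)
        < exp (- (n / 4) * (sqrt (1 + 2 * r / n) - 1)\<^sup>2)"
      using m_infinity_less_Laurent_Massart[OF n r] .
  next
    assume "n \<ge> 2 \<and> r \<ge> n - 1"
    then show "(1 + r / n) powr (n / 2) * exp (- r / 2)
        < 1 / sqrt (exp 1) * (exp 1 * (1 + r) / n) powr (n / 2) * exp (- r / 2)"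
      using m_infinity_less_large_deviations[of n r] by simp
  qed
qed

end
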